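(* Let $G=(V,E)$ be a finite, simple, connected, unweighted graph and let $\Lambda$ be an eigenspace of its Laplacian $L$ with $\dim\Lambda>1$. For any nonempty $W\subset V$, either $W$ integrates $\Lambda$, or for each $j=0,\ldots,\dim\Lambda-1$ there is an orthonormal basis of $\Lambda$ such that $W$ integrates precisely $j$ of the eigenvectors in this basis.
   Context: The Laplacian is $L=AD^{-1}-I$, where $A$ is the adjacency matrix of $G$ and $D$ its diagonal degree matrix. Eigenvectors are regarded as functions $\phi:V\to\mathbb{R}$, and orthonormality is with respect to the standard inner product on $\mathbb{R}^V$. $W$ integrates $\phi$ if $\frac{1}{|W|}\sum_{w\in W}\phi(w)=\frac{1}{|V|}\sum_{v\in V}\phi(v)$; $W$ integrates the eigenspace $\Lambda$ if it integrates every eigenvector in a basis of $\Lambda$ (equivalently, every vector of $\Lambda$). *)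

theory Defs
  imports "HOL-Analysis.Analysis" "Graph_Theory.Graph_Theory"
begin

text \<open>
  A finite simple graph is a \<^locale>\<open>pair_graph\<close>: each undirected edge is
  represented by its two opposite arcs, so the degree of a vertex is its \<^const>\<open>out_degree\<close>.
  The vertex set is a finite type, so that functions on the vertices are
  vectors and the matrices below are square matrices over that type.
\<close>

definition adjacency_matrix :: "'v::finite pair_pre_digraph \<Rightarrow> real^'v^'v" where
  "adjacency_matrix G = (\<chi> u v. if (u, v) \<in> parcs G then 1 else 0)"

definition degree_matrix :: "'v::finite pair_pre_digraph \<Rightarrow> real^'v^'v" where
  "degree_matrix G = (\<chi> u v. if u = v then real (out_degree (with_proj G) u) else 0)"

text \<open>
  The inverse is a genuine one unless some degree is zero; a connected graph with an
  isolated vertex has only one vertex, hence no eigenspace of dimension greater than 1.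
\<close>

definition laplacian :: "'v::finite pair_pre_digraph \<Rightarrow> real^'v^'v" where
  "laplacian G = adjacency_matrix G ** matrix_inv (degree_matrix G) - mat 1"

definition eigenspace :: "real^'v^'v \<Rightarrow> real \<Rightarrow> (real^'v::finite) set" where
  "eigenspace M \<mu> = {\<phi>. M *v \<phi> = \<mu> *\<^sub>R \<phi>}"

definition integrates :: "'v::finite set \<Rightarrow> real^'v \<Rightarrow> bool" where
  "integrates W \<phi> \<longleftrightarrow>
     1 / real (card W) * (\<Sum>w\<in>W. \<phi> $ w) = 1 / real CARD('v) * (\<Sum>v\<in>UNIV. \<phi> $ v)"

definition basis_of :: "(real^'v::finite) set \<Rightarrow> (real^'v) set \<Rightarrow> bool" where
  "basis_of \<Lambda> B \<longleftrightarrow> B \<subseteq> \<Lambda> \<and> independent B \<and> span B = \<Lambda>"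

definition orthonormal_basis_of :: "(real^'v::finite) set \<Rightarrow> (real^'v) set \<Rightarrow> bool" where
  "orthonormal_basis_of \<Lambda> B \<longleftrightarrow>
     basis_of \<Lambda> B \<and> pairwise orthogonal B \<and> (\<forall>\<phi>\<in>B. norm \<phi> = 1)"

definition integrates_space :: "'v::finite set \<Rightarrow> (real^'v) set \<Rightarrow> bool" where
  "integrates_space W \<Lambda> \<longleftrightarrow> (\<exists>B. basis_of \<Lambda> B \<and> (\<forall>\<phi>\<in>B. integrates W \<phi>))"

end

theory Submission
  imports Defs
begin

text \<open>
  That \<open>W\<close> integrates a function is one linear condition on it: orthogonality to the discrepancy
  vector \<open>g = 1\<^sub>W / |W| - 1 / |V|\<close>. On the eigenspace \<open>\<Lambda>\<close> only the orthogonal projection \<open>h\<close> of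
  \<open>g\<close> matters. If \<open>h = 0\<close>, then every vector of \<open>\<Lambda>\<close> is integrated. Otherwise the claim is a
  fact about an arbitrary nonzero vector \<open>h\<close> of an arbitrary subspace: for every
  \<open>j < dim \<Lambda>\<close> some orthonormal basis has exactly \<open>j\<close> members orthogonal to \<open>h\<close>
  (\<open>orthonormal_basis_card_orthogonal\<close>).

  To see this, it is easier to choose the vector for a given basis than the basis for a given
  vector. The sum \<open>u\<close> of \<open>dim \<Lambda> - j\<close> members of an orthonormal basis is orthogonal to exactly
  the \<open>j\<close> other members. Because \<open>j < dim \<Lambda>\<close>, \<open>u\<close> is not zero, so a reflection of \<open>\<Lambda>\<close> (or the
  identity, if \<open>u\<close> already has the direction of \<open>h\<close>) maps it to a positive multiple of \<open>h\<close>, and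
  the image of the basis under this map is the basis that is wanted.
\<close>

lemma orthonormal_image:
  fixes f :: "'a::euclidean_space \<Rightarrow> 'a"
  assumes f: "orthogonal_transformation f"
    and B: "pairwise orthogonal B" "\<forall>x\<in>B. norm x = 1"
  shows "pairwise orthogonal (f ` B)" "\<forall>x\<in>f ` B. norm x = 1" "independent (f ` B)"
proof -
  show orth: "pairwise orthogonal (f ` B)"
    using B(1) f unfolding pairwise_def orthogonal_def orthogonal_transformation_def by auto
  show norm1: "\<forall>x\<in>f ` B. norm x = 1"
    using B(2) f by (auto simp: orthogonal_transformation_norm)
  have "0 \<notin> f ` B"
    using norm1 by (metis norm_zero zero_neq_one)
  then show "independent (f ` B)"
    by (rule pairwise_orthogonal_independent[OF orth])
qed

text \<open>
  The Householder reflection in the hyperplane orthogonal to \<open>n = u - v\<close>. Being orthogonal and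
  its own inverse, it can be moved across an inner product unchanged. It moves points along \<open>n\<close>
  only, and hence preserves every subspace that contains \<open>u\<close> and \<open>v\<close>.
\<close>

lemma reflection_swap_exists:
  fixes u v :: "'a::euclidean_space"
  assumes uv: "norm u = norm v" and S: "subspace S" "u \<in> S" "v \<in> S"
  obtains f where "orthogonal_transformation f" "f v = u" "\<And>x y. f x \<bullet> y = x \<bullet> f y"
    "f ` S \<subseteq> S"
proof
  define n where "n = u - v"
  \<comment> \<open>If \<open>u = v\<close>, then \<open>n = 0\<close> and \<open>f\<close> is the identity, because the quotient by 0 is 0.\<close>
  define f where "f x = x - (2 * (x \<bullet> n) / (n \<bullet> n)) *\<^sub>R n" for x
  have "linear f"
    by (rule linearI) (simp_all add: f_def algebra_simps inner_add_left add_divide_distrib)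
  moreover have "f x \<bullet> f y = x \<bullet> y" for x y
    by (cases "n = 0") (simp_all add: f_def algebra_simps inner_diff_left inner_diff_right inner_commute)
  ultimately show "orthogonal_transformation f"
    by (simp add: orthogonal_transformation_def)
  show "f x \<bullet> y = x \<bullet> f y" for x y
    by (simp add: f_def inner_diff_left inner_diff_right inner_commute)
  \<comment> \<open>Equal norms put \<open>u\<close> and \<open>v\<close> on opposite sides of the mirror, at equal distance from it.\<close>
  have "2 * (v \<bullet> n) = - (n \<bullet> n)"
    using uv by (simp add: n_def norm_eq inner_diff_left inner_diff_right inner_commute)
  then show "f v = u"
    by (cases "n = 0") (auto simp: f_def n_def)
  have "n \<in> S"
    unfolding n_def using S by (simp add: subspace_diff)
  then show "f ` S \<subseteq> S"
    using S(1) by (auto simp: f_def intro!: subspace_diff subspace_scale)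
qed

text \<open>
  Start from any orthonormal basis \<open>C\<close> of \<open>S\<close> and the sum \<open>u\<close> of a subset \<open>T\<close> of it. A symmetric
  orthogonal map \<open>f\<close> that takes a multiple of \<open>h\<close> to \<open>u\<close> makes \<open>f x\<close> orthogonal to \<open>h\<close> exactly
  when \<open>x\<close> is orthogonal to \<open>u\<close>, that is, when \<open>x\<close> lies outside \<open>T\<close>; so the size of \<open>T\<close>
  prescribes the count.
\<close>

lemma orthonormal_basis_card_orthogonal:
  fixes h :: "'a::euclidean_space"
  assumes S: "subspace S" and h: "h \<in> S" "h \<noteq> 0" and j: "j < dim S"
  obtains B where "B \<subseteq> S" "independent B" "span B = S" "pairwise orthogonal B"
    "\<forall>x\<in>B. norm x = 1" "card {x \<in> B. h \<bullet> x = 0} = j"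
proof -
  obtain C where C: "C \<subseteq> S" "pairwise orthogonal C" "\<And>x. x \<in> C \<Longrightarrow> norm x = 1"
    "independent C" "card C = dim S" "span C = S"
    using orthonormal_basis_subspace[OF S] by metis
  have finC: "finite C"
    using C(4) by (rule independent_imp_finite)
  obtain T where T: "T \<subseteq> C" "card T = dim S - j"
    by (metis C(5) diff_le_self obtain_subset_with_card_n)
  define u where "u = \<Sum>T"
  have u_inner: "u \<bullet> x = (if x \<in> T then 1 else 0)" if x: "x \<in> C" for x
  proof -
    have "y \<bullet> x = (if y = x then 1 else 0)" if "y \<in> T" for y
      using that x T(1) C(2) C(3)[OF x]
      by (auto simp: pairwise_def orthogonal_def dot_square_norm)
    then have "u \<bullet> x = (\<Sum>y\<in>T. if y = x then 1 else 0)"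
      unfolding u_def inner_sum_left by (rule sum.cong[OF refl])
    then show ?thesis
      using finite_subset[OF T(1) finC] by simp
  qed
  have "u \<noteq> 0"
  proof -
    obtain t where "t \<in> T"
      using T(2) j by (metis card.empty equals0I zero_less_diff less_irrefl)
    then show ?thesis
      using u_inner[of t] T(1) by auto
  qed
  define c where "c = norm u / norm h"
  have c: "c > 0" "norm u = norm (c *\<^sub>R h)"
    using \<open>u \<noteq> 0\<close> h(2) by (simp_all add: c_def)
  have "u \<in> S" "c *\<^sub>R h \<in> S"
    unfolding u_def using T(1) C(1) S h(1) by (auto intro: subspace_sum subspace_scale)
  then obtain f where f: "orthogonal_transformation f" "f (c *\<^sub>R h) = u"
    "\<And>x y. f x \<bullet> y = x \<bullet> f y" "f ` S \<subseteq> S"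
    using reflection_swap_exists[OF c(2) S] by metis
  have inj: "inj f"
    using f(1) by (rule orthogonal_transformation_inj)
  have ind: "independent (f ` C)"
    using orthonormal_image[OF f(1) C(2)] C(3) by blast
  have sub: "f ` C \<subseteq> S"
    using f(4) C(1) by blast
  have "card (f ` C) = dim S"
    using C(5) card_image[OF inj_on_subset[OF inj subset_UNIV]] by simp
  then have span: "span (f ` C) = S"
    using sub ind S card_ge_dim_independent[OF sub ind] span_minimal[OF sub S] by auto
  \<comment> \<open>Being symmetric, \<open>f\<close> carries the known inner products with \<open>u\<close> over to \<open>h\<close>.\<close>
  have "h \<bullet> f x = 0 \<longleftrightarrow> x \<notin> T" if "x \<in> C" for x
  proof -
    have "c * (h \<bullet> f x) = u \<bullet> x"
      using f(2) f(3)[of "c *\<^sub>R h" x] by simp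
    then show ?thesis
      using u_inner[OF that] c(1) by (auto split: if_splits)
  qed
  then have "{x \<in> f ` C. h \<bullet> x = 0} = f ` (C - T)"
    by auto
  then have "card {x \<in> f ` C. h \<bullet> x = 0} = card (C - T)"
    using card_image[OF inj_on_subset[OF inj subset_UNIV]] by simp
  also have "\<dots> = j"
    using T finC j C(5) by (simp add: card_Diff_subset finite_subset)
  finally show thesis
    using that[OF sub ind span] orthonormal_image[OF f(1) C(2)] C(3) by blast
qed

lemma subspace_eigenspace: "subspace (eigenspace M \<mu>)"
  by (simp add: subspace_def eigenspace_def matrix_vector_right_distrib
      matrix_vector_mult_scaleR algebra_simps)

definition discrepancy_vector :: "'v::finite set \<Rightarrow> real^'v" where
  "discrepancy_vector W =
     (\<chi> v. (if v \<in> W then 1 / real (card W) else 0) - 1 / real CARD('v))"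

lemma integrates_iff_orthogonal_discrepancy:
  fixes \<phi> :: "real^'v::finite"
  shows "integrates W \<phi> \<longleftrightarrow> discrepancy_vector W \<bullet> \<phi> = 0"
proof -
  let ?mean = "1 / real CARD('v) * (\<Sum>v\<in>UNIV. \<phi> $ v)"
  have "discrepancy_vector W \<bullet> \<phi> =
      (\<Sum>v\<in>UNIV. if v \<in> W then 1 / real (card W) * \<phi> $ v else 0) - ?mean"
    unfolding discrepancy_vector_def inner_vec_def sum_distrib_left sum_subtractf[symmetric]
    by (intro sum.cong) (auto simp: left_diff_distrib)
  also have "(\<Sum>v\<in>UNIV. if v \<in> W then 1 / real (card W) * \<phi> $ v else 0) =
      1 / real (card W) * (\<Sum>w\<in>W. \<phi> $ w)"
    unfolding sum_distrib_left by (simp add: sum.If_cases)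
  finally show ?thesis
    by (simp add: integrates_def)
qed

theorem lemma3p2:
  fixes G :: "'v::finite pair_pre_digraph"
    and \<mu> :: real
    and \<Lambda> :: "(real^'v) set"
    and W :: "'v set"
  assumes "pair_graph G"
    and "pverts G = UNIV"
    and "Digraph_Component.connected (with_proj G)"
    and "\<Lambda> = eigenspace (laplacian G) \<mu>"
    and "dim \<Lambda> > 1"
    and "W \<noteq> {}"
  shows "integrates_space W \<Lambda> \<or>
    (\<forall>j\<in>{0..dim \<Lambda> - 1}. \<exists>B. orthonormal_basis_of \<Lambda> B \<and> card {\<phi> \<in> B. integrates W \<phi>} = j)"
proof -
  have S: "subspace \<Lambda>"
    using assms(4) by (simp add: subspace_eigenspace)
  obtain h z where h: "h \<in> \<Lambda>" "\<And>\<phi>. \<phi> \<in> \<Lambda> \<Longrightarrow> orthogonal z \<phi>" "discrepancy_vector W = h + z"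
    using orthogonal_subspace_decomp_exists[of \<Lambda> "discrepancy_vector W"] span_eq_iff[of \<Lambda>] S by metis
  have integrates_h: "integrates W \<phi> \<longleftrightarrow> h \<bullet> \<phi> = 0" if "\<phi> \<in> \<Lambda>" for \<phi>
    using h(2)[OF that] by (simp add: integrates_iff_orthogonal_discrepancy h(3)
        inner_add_left orthogonal_def)
  show ?thesis
  proof (cases "h = 0")
    case True
    obtain B where "B \<subseteq> \<Lambda>" "independent B" "span B = \<Lambda>"
      using orthonormal_basis_subspace[OF S] by metis
    then have "basis_of \<Lambda> B" "\<forall>\<phi>\<in>B. integrates W \<phi>"
      using True integrates_h by (auto simp: basis_of_def)
    then show ?thesis
      by (auto simp: integrates_space_def)
  next
    case False
    have "\<exists>B. orthonormal_basis_of \<Lambda> B \<and> card {\<phi> \<in> B. integrates W \<phi>} = j"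
      if "j \<in> {0..dim \<Lambda> - 1}" for j
    proof -
      have "j < dim \<Lambda>"
        using that assms(5) by auto
      then obtain B where B: "B \<subseteq> \<Lambda>" "independent B" "span B = \<Lambda>" "pairwise orthogonal B"
        "\<forall>x\<in>B. norm x = 1" "card {x \<in> B. h \<bullet> x = 0} = j"
        by (rule orthonormal_basis_card_orthogonal[OF S h(1) False])
      have "{\<phi> \<in> B. integrates W \<phi>} = {x \<in> B. h \<bullet> x = 0}"
        using B(1) integrates_h by blast
      then show ?thesis
        using B by (auto simp: orthonormal_basis_of_def basis_of_def)
    qed
    then show ?thesis
      by blast
  qed
qed

end
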